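(* Let $f\in\mathbb{Z}[X]$ and $c\in\mathbb{Z}\setminus\{0\}$. For $d\in\mathbb{N}$ let $$f_d=c\sum_{j=0}^{d-1}\prod_{i=0}^{j-1}f(X-i)\in\mathbb{Z}[X].$$ Assume that $d\ge3$, that there is an integer $n_0$ which is the greatest real root of $f$, and that $f$ as a function is (strictly) decreasing on the set $[n_0+1,+\infty)\cap\mathbb{Z}$. Then $f_d$ has at least $d-2$ real roots. More precisely, $f_d$ has a root in the interval $(n_0+l,n_0+l+1)$ for each $l\in\{2,3,\dots,d-2\}$, and (1) if $f(n_0+1)<-1$ or $f_d'(n_0+1)\ne0$, then $f_d$ has $2$ real roots in the interval $(n_0,n_0+2)$; (2) if $f(n_0+1)=-1$, then $f_d(n_0+1)=0$. In particular, if $\deg f=1$, then $f_d$ factorizes into linear polynomials with real coefficients.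
   Context: $\mathbb{N}=\{0,1,2,\dots\}$. Empty products equal $1$ and empty sums equal $0$; $f_d'$ denotes the derivative of $f_d$. (These polynomials are related to the sequence $a_0=c$, $a_n=f(n)a_{n-1}+c$ for $n>0$.) *)

theory Defs
  imports Complex_Main "HOL-Computational_Algebra.Polynomial"
begin

definition fpoly :: "int poly \<Rightarrow> int \<Rightarrow> nat \<Rightarrow> int poly" where
  "fpoly f c d = smult c (\<Sum>j<d. \<Prod>i<j. pcompose f [:- int i, 1:])"

abbreviation real_poly_of :: "int poly \<Rightarrow> real poly" where
  "real_poly_of \<equiv> map_poly real_of_int"

end

theory Submission
  imports Defs
begin

text \<open>At the integers \<open>n0 + k\<close> with \<open>0 \<le> k < d\<close> the vanishing of \<open>f n0\<close> truncates the sum defining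
  \<open>f_d\<close>, so its value is \<open>c * S k\<close> with \<open>S 0 = 1\<close> and
  \<open>S k = 1 + f (n0 + k) * S (k - 1)\<close>. Since \<open>f\<close> has no root beyond \<open>n0\<close> and strictly decreases
  through the integers, \<open>f (n0 + k) \<le> -k\<close> for \<open>k \<ge> 1\<close>. Hence \<open>S 1 \<le> 0\<close>, the signs of \<open>S k\<close>
  alternate for \<open>k \<ge> 2\<close>, and the roots come from the intermediate value theorem. If
  \<open>f (n0 + 1) = -1\<close>, then \<open>n0 + 1\<close> is a root, and when it is simple the second one is found by
  dividing out the linear factor. For linear \<open>f\<close> the degree of \<open>f_d\<close> is at most \<open>d - 1\<close>, and a
  real polynomial of degree \<open>m\<close> with at least \<open>m - 1\<close> roots splits.\<close>

lemma poly_real_poly_of_int: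
  "poly (real_poly_of p) (real_of_int x) = real_of_int (poly p x)"
  by (induction p) (simp_all add: map_poly_pCons)

lemma pderiv_real_poly_of: "pderiv (real_poly_of p) = real_poly_of (pderiv p)"
  by (rule poly_eqI) (simp add: coeff_pderiv coeff_map_poly)

lemma poly_IVT_int:
  fixes p :: "int poly"
  assumes "a < b" "poly p a * poly p b < 0"
  obtains x where "real_of_int a < x" "x < real_of_int b" "poly (real_poly_of p) x = 0"
proof -
  have "poly (real_poly_of p) (real_of_int a) * poly (real_poly_of p) (real_of_int b) < 0"
    using assms(2) by (simp add: poly_real_poly_of_int flip: of_int_mult)
  then show thesis
    using poly_IVT[of "real_of_int a" "real_of_int b" "real_poly_of p"] assms(1) that by auto
qed

text \<open>Write \<open>p = (X - m) * q\<close>. Simplicity of the root \<open>m\<close> gives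
  \<open>poly q m \<noteq> 0\<close>. As \<open>X - m\<close> changes sign between \<open>a\<close>
  and \<open>b\<close> while \<open>p\<close> does not, \<open>q\<close> must, and its root there
  differs from \<open>m\<close>.\<close>

lemma poly_second_root:
  fixes p :: "real poly"
  assumes "a < m" "m < b" "poly p m = 0" "poly (pderiv p) m \<noteq> 0" "poly p a * poly p b > 0"
  obtains x where "a < x" "x < b" "x \<noteq> m" "poly p x = 0"
proof -
  obtain q where q: "p = [:- m, 1:] * q"
    using assms(3) by (auto simp: poly_eq_0_iff_dvd)
  have "poly q m \<noteq> 0"
    using assms(4) unfolding q by (simp add: pderiv_mult pderiv_pCons del: mult_pCons_left)
  moreover have "((a - m) * (b - m)) * (poly q a * poly q b) > 0"
    using assms(5) unfolding q by (simp add: algebra_simps)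
  then have "poly q a * poly q b < 0"
    using mult_neg_pos[of "a - m" "b - m"] assms(1,2) by (auto simp: zero_less_mult_iff)
  then obtain x where "a < x" "x < b" "poly q x = 0"
    using poly_IVT[of a b q] assms(1,2) by auto
  ultimately show thesis
    using that[of x] unfolding q by auto
qed

text \<open>Dividing out a root lowers the degree by one and loses at most one distinct root, so the
  bound is inherited by the quotient. It supplies a root as long as the degree is at least 2, and
  what remains at degree 1 is itself a linear factor.\<close>

lemma poly_splits_if_card_roots:
  fixes p :: "real poly"
  assumes "degree p > 0" "card {x. poly p x = 0} \<ge> degree p - 1"
  shows "\<exists>ps. (\<forall>q\<in>set ps. degree q = 1) \<and> p = prod_list ps"
  using assms
proof (induction "degree p" arbitrary: p rule: less_induct)
  case less
  show ?case
  proof (cases "degree p = 1")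
    case True
    then show ?thesis by (intro exI[of _ "[p]"]) simp
  next
    case False
    with less.prems have "card {x. poly p x = 0} > 0" by linarith
    then obtain a where "poly p a = 0" by (auto simp: card_gt_0_iff)
    then obtain q where q: "p = [:- a, 1:] * q" by (auto simp: poly_eq_0_iff_dvd)
    have "q \<noteq> 0" using less.prems(1) q by auto
    then have deg: "degree p = Suc (degree q)"
      unfolding q by (subst degree_mult_eq) auto
    have "card {x. poly p x = 0} \<le> card (insert a {x. poly q x = 0})"
      unfolding q using poly_roots_finite[OF \<open>q \<noteq> 0\<close>] by (intro card_mono) auto
    also have "\<dots> \<le> Suc (card {x. poly q x = 0})" by (rule card_insert_le_m1) auto
    finally have "card {x. poly q x = 0} \<ge> degree q - 1"
      using less.prems(2) deg by linarith
    then obtain ps where "\<forall>r\<in>set ps. degree r = 1" "q = prod_list ps"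
      using less.hyps[of q] deg False by auto
    then show ?thesis using q by (intro exI[of _ "[:- a, 1:] # ps"]) simp
  qed
qed

text \<open>This is the sequence \<open>a_n = f(n) a_{n-1} + c\<close> with the constant
  \<open>c\<close> scaled to 1 and \<open>g\<close> in the role of \<open>f\<close>.\<close>

primrec affine_rec :: "(nat \<Rightarrow> int) \<Rightarrow> nat \<Rightarrow> int" where
  "affine_rec g 0 = 1"
| "affine_rec g (Suc k) = 1 + g (Suc k) * affine_rec g k"

text \<open>Horner's scheme: the summand for \<open>j = 0\<close> is 1, and all others share the
  factor for \<open>i = 0\<close>.\<close>

lemma affine_rec_eq_sum: "affine_rec g k = (\<Sum>j\<le>k. \<Prod>i<j. g (k - i))"
proof (induction k)
  case (Suc k)
  then show ?case
    by (simp only: affine_rec.simps sum.atMost_Suc_shift prod.lessThan_Suc_shift)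
      (simp add: sum_distrib_left)
qed simp

text \<open>The induction starts at 2 because the value at 1 may vanish. From there on, a nonzero
  integer has absolute value at least 1, and multiplying it by \<open>g (Suc k) \<le> -2\<close>
  flips the sign and gives absolute value at least 2, which the added 1 cannot cancel.\<close>

lemma affine_rec_sign:
  assumes "\<And>k. k \<ge> 1 \<Longrightarrow> g k \<le> - int k" "k \<ge> 2"
  shows "(-1) ^ k * affine_rec g k > 0"
  using assms(2)
proof (induction k rule: dec_induct)
  case base
  have "g 1 \<le> -1" "g 2 \<le> -2" using assms(1)[of 1] assms(1)[of 2] by auto
  then have "g 2 * (1 + g 1) \<ge> 0" by (intro mult_nonpos_nonpos) auto
  then show ?case by (simp add: numeral_2_eq_2)
next
  case (step k)
  let ?s = "(-1) ^ k * affine_rec g k"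
  have "g (Suc k) \<le> -2" using assms(1)[of "Suc k"] step.hyps by auto
  moreover have "?s \<ge> 1" using step.IH by linarith
  ultimately have "(- g (Suc k)) * ?s \<ge> 2 * 1" by (intro mult_mono) auto
  moreover have "(-1) ^ Suc k * affine_rec g (Suc k) = (- g (Suc k)) * ?s - (-1) ^ k"
    by (simp add: algebra_simps)
  moreover have "(-1) ^ k \<le> (1::int)" by (cases "even k") auto
  ultimately show ?case by linarith
qed

lemma poly_fpoly_at_int:
  assumes "poly f n0 = 0" "k < d"
  shows "poly (fpoly f c d) (n0 + int k) = c * affine_rec (\<lambda>m. poly f (n0 + int m)) k"
proof -
  have "poly (fpoly f c d) (n0 + int k) = c * (\<Sum>j<d. \<Prod>i<j. poly f (n0 + int k - int i))"
    by (simp add: fpoly_def poly_sum poly_prod poly_pcompose algebra_simps)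
  \<comment> \<open>For \<open>j > k\<close> the product contains the factor for
    \<open>i = k\<close>, which is \<open>poly f n0 = 0\<close>.\<close>
  also have "(\<Sum>j<d. \<Prod>i<j. poly f (n0 + int k - int i)) =
      (\<Sum>j\<le>k. \<Prod>i<j. poly f (n0 + int k - int i))"
    using assms by (intro sum.mono_neutral_right) (auto intro!: bexI[of _ k])
  also have "\<dots> = affine_rec (\<lambda>m. poly f (n0 + int m)) k"
    unfolding affine_rec_eq_sum by (intro sum.cong prod.cong) (auto simp: of_nat_diff algebra_simps)
  finally show ?thesis .
qed

lemma degree_fpoly_le:
  assumes "degree f \<le> 1"
  shows "degree (fpoly f c d) \<le> d - 1"
proof -
  have "degree (\<Prod>i<j. pcompose f [:- int i, 1:]) \<le> d - 1" if "j < d" for j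
  proof -
    have "degree (\<Prod>i<j. pcompose f [:- int i, 1:]) \<le>
        (\<Sum>i<j. degree (pcompose f [:- int i, 1:]))"
      using degree_prod_sum_le[of "{..<j}" "\<lambda>i. pcompose f [:- int i, 1:]"] by (simp add: o_def)
    also have "\<dots> \<le> (\<Sum>i<j. 1)" using assms by (intro sum_mono) (simp add: degree_pcompose)
    finally show ?thesis using that by simp
  qed
  then have "degree (\<Sum>j<d. \<Prod>i<j. pcompose f [:- int i, 1:]) \<le> d - 1"
    by (intro degree_sum_le) auto
  then show ?thesis
    unfolding fpoly_def using degree_smult_le le_trans by blast
qed

text \<open>A strictly decreasing integer sequence drops by at least 1 per step, so it suffices that
  the value at \<open>n0 + 1\<close> is negative. If it were positive, the values would eventually
  become negative and force a root beyond \<open>n0\<close>.\<close>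

lemma poly_beyond_last_root_le:
  fixes f :: "int poly"
  assumes noroot: "\<forall>x::real. poly (real_poly_of f) x = 0 \<longrightarrow> x \<le> real_of_int n0"
    and anti: "strict_antimono_on {n0 + 1..} (poly f)"
    and "k \<ge> 1"
  shows "poly f (n0 + int k) \<le> - int k"
proof -
  have drop: "poly f (n0 + int (m + j)) \<le> poly f (n0 + int m) - int j" if "m \<ge> 1" for m j
  proof (induction j)
    case (Suc j)
    have "poly f (n0 + int (m + Suc j)) < poly f (n0 + int (m + j))"
      using that by (intro monotone_onD[OF anti]) auto
    with Suc show ?case by simp
  qed simp
  have nz: "poly f (n0 + int m) \<noteq> 0" if "m \<ge> 1" for m
    using noroot[rule_format, of "real_of_int (n0 + int m)"] that
    by (auto simp: poly_real_poly_of_int simp del: of_int_add)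
  have "poly f (n0 + 1) < 0"
  proof (rule ccontr)
    assume "\<not> poly f (n0 + 1) < 0"
    then have pos: "poly f (n0 + 1) > 0" using nz[of 1] by simp
    \<comment> \<open>After \<open>poly f (n0 + 1)\<close> unit drops the value is at most 0, and it
      cannot be 0.\<close>
    define M where "M = 1 + nat (poly f (n0 + 1))"
    have "poly f (n0 + int M) < 0"
      using drop[of 1 "nat (poly f (n0 + 1))"] nz[of M] pos by (simp add: M_def)
    then have "poly f (n0 + 1) * poly f (n0 + int M) < 0"
      using pos by (simp add: mult_pos_neg)
    moreover have "n0 + 1 < n0 + int M" using pos by (simp add: M_def)
    ultimately obtain x where "real_of_int (n0 + 1) < x" "poly (real_poly_of f) x = 0"
      by (metis poly_IVT_int)
    with noroot show False by fastforce
  qed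
  then show ?thesis using drop[of 1 "k - 1"] \<open>k \<ge> 1\<close> by (simp add: of_nat_diff)
qed

theorem theorem10:
  fixes f :: "int poly" and c n0 :: int and d :: nat
  assumes "c \<noteq> 0"
    and "d \<ge> 3"
    and "poly (real_poly_of f) (real_of_int n0) = 0"
    and "\<forall>x::real. poly (real_poly_of f) x = 0 \<longrightarrow> x \<le> real_of_int n0"
    and "strict_antimono_on {n0 + 1..} (poly f)"
  shows "card {x::real. poly (real_poly_of (fpoly f c d)) x = 0} \<ge> d - 2
    \<and> (\<forall>l\<in>{2..d - 2}. \<exists>x\<in>{real_of_int n0 + real l <..< real_of_int n0 + real l + 1}.
          poly (real_poly_of (fpoly f c d)) x = 0)
    \<and> (poly f (n0 + 1) < -1 \<or> poly (pderiv (fpoly f c d)) (n0 + 1) \<noteq> 0 \<longrightarrow>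
          card {x \<in> {real_of_int n0 <..< real_of_int n0 + 2}.
                  poly (real_poly_of (fpoly f c d)) x = 0} \<ge> 2)
    \<and> (poly f (n0 + 1) = -1 \<longrightarrow> poly (fpoly f c d) (n0 + 1) = 0)
    \<and> (degree f = 1 \<longrightarrow>
          (\<exists>ps :: real poly list. (\<forall>p\<in>set ps. degree p = 1)
             \<and> real_poly_of (fpoly f c d) = prod_list ps))"
proof -
  define g where "g = (\<lambda>m. poly f (n0 + int m))"
  define S where "S = affine_rec g"
  define F where "F = fpoly f c d"
  define R where "R = {x::real. poly (real_poly_of F) x = 0}"
  have "poly f n0 = 0" using assms(3) by (simp add: poly_real_poly_of_int)
  then have val: "poly F (n0 + int k) = c * S k" if "k < d" for k
    using poly_fpoly_at_int[of f n0 k d c] that by (simp add: F_def S_def g_def)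
  have g_le: "g k \<le> - int k" if "k \<ge> 1" for k
    using poly_beyond_last_root_le[OF assms(4,5) that] by (simp add: g_def)
  have S0: "S 0 = 1" and S1: "S 1 = 1 + g 1" by (simp_all add: S_def)
  have sign: "(-1) ^ k * S k > 0" if "k \<ge> 2" for k
    unfolding S_def by (rule affine_rec_sign[OF g_le that])
  have S2: "S 2 > 0" using sign[of 2] by simp
  have g1: "g 1 \<le> -1" using g_le[of 1] by simp
  have cc: "c * c > 0" using assms(1) by (auto simp: zero_less_mult_iff)
  have "poly F n0 = c" using val[of 0] assms(2) S0 by simp
  then have F0: "F \<noteq> 0" using assms(1) by auto
  then have RF0: "real_poly_of F \<noteq> 0" by (simp add: map_poly_eq_0_iff)
  then have finR: "finite R" unfolding R_def by (rule poly_roots_finite)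

  have root_between: "\<exists>x\<in>R. real_of_int n0 + real k < x \<and> x < real_of_int n0 + real k + 1"
    if "Suc k < d" "S k * S (Suc k) < 0" for k
  proof -
    have "poly F (n0 + int k) * poly F (n0 + int (Suc k)) = (c * c) * (S k * S (Suc k))"
      using that(1) val[of k] val[of "Suc k"] by (simp add: mult_ac)
    also have "\<dots> < 0" using cc that(2) by (rule mult_pos_neg)
    finally show ?thesis
      by (rule poly_IVT_int[rotated]) (auto simp: R_def intro!: bexI)
  qed
  have alt: "S l * S (Suc l) < 0" if "l \<ge> 2" for l
    using sign[of l] sign[of "Suc l"] that
    by (cases "even l") (auto simp: mult_pos_neg mult_neg_pos)
  have roots: "\<exists>x\<in>R. real_of_int n0 + real l < x \<and> x < real_of_int n0 + real l + 1"
    if "l \<in> {2..d - 2}" for l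
    using that assms(2) by (intro root_between alt) auto
  have root1: "real_of_int n0 + 1 \<in> R" if "g 1 = -1"
  proof -
    have "poly F (n0 + 1) = 0" using val[of 1] assms(2) S1 that by simp
    then show ?thesis using poly_real_poly_of_int[of F "n0 + 1"] by (simp add: R_def)
  qed

  \<comment> \<open>The intervals are closed on the right to admit the root \<open>n0 + 1\<close>
    for \<open>l = 0\<close>, and they stay disjoint. The index \<open>l = 1\<close> is left out
    since \<open>S 1\<close> may be 0; the remaining ones number
    \<open>1 + (d - 3) = d - 2\<close>.\<close>
  have "\<exists>x\<in>R. real_of_int n0 + real l < x \<and> x \<le> real_of_int n0 + real l + 1"
    if l: "l \<in> insert 0 {2..d - 2}" for l
  proof (cases "l = 0")
    case True
    show ?thesis
    proof (cases "g 1 = -1")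
      case True
      then show ?thesis using root1 \<open>l = 0\<close> by (intro bexI[of _ "real_of_int n0 + 1"]) auto
    next
      case False
      then have "S 0 * S (Suc 0) < 0" using S0 S1 g1 by simp
      then show ?thesis using root_between[of 0] \<open>l = 0\<close> assms(2) by force
    qed
  next
    case False
    then show ?thesis using roots[of l] l by force
  qed
  then obtain r where r: "\<And>l. l \<in> insert 0 {2..d - 2} \<Longrightarrow>
      r l \<in> R \<and> real_of_int n0 + real l < r l \<and> r l \<le> real_of_int n0 + real l + 1"
    by metis
  \<comment> \<open>Rounding up recovers \<open>l\<close> from the chosen root, so distinct indices
    give distinct roots.\<close>
  have ceil: "\<lceil>r l\<rceil> = n0 + int l + 1" if "l \<in> insert 0 {2..d - 2}" for l
    using r[OF that] by (intro ceiling_unique) auto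
  have "inj_on r (insert 0 {2..d - 2})"
    by (rule inj_onI) (metis ceil add_left_cancel add_right_cancel of_nat_eq_iff)
  then have "card (insert 0 {2..d - 2}) \<le> card R"
    using r finR by (intro card_inj_on_le) auto
  then have cardR: "card R \<ge> d - 2" using assms(2) by (simp add: card_insert_if Suc_diff_le)

  have two: "card {x \<in> {real_of_int n0 <..< real_of_int n0 + 2}. poly (real_poly_of F) x = 0} \<ge> 2"
    if hyp: "g 1 < -1 \<or> poly (pderiv F) (n0 + 1) \<noteq> 0"
  proof -
    have "\<exists>x y. x \<noteq> y \<and> {x, y} \<subseteq> {x \<in> {real_of_int n0 <..< real_of_int n0 + 2}. x \<in> R}"
    proof (cases "g 1 < -1")
      case True
      \<comment> \<open>Here \<open>S 1 = 1 + g 1\<close> is strictly negative, between the positive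
        \<open>S 0\<close> and \<open>S 2\<close>.\<close>
      have "S 0 * S (Suc 0) < 0" "S 1 * S (Suc 1) < 0"
        using True S0 S1 S2 by (simp_all add: mult_neg_pos numeral_2_eq_2)
      then obtain x y where "x \<in> R" "real_of_int n0 < x" "x < real_of_int n0 + 1"
        "y \<in> R" "real_of_int n0 + 1 < y" "y < real_of_int n0 + 2"
        using root_between[of 0] root_between[of 1] assms(2) by fastforce
      then show ?thesis by (intro exI[of _ x] exI[of _ y]) auto
    next
      case False
      then have g1': "g 1 = -1" using g1 by simp
      let ?n = "real_of_int n0"
      \<comment> \<open>Now \<open>n0 + 1\<close> is a simple root, and equal signs at
        \<open>n0\<close> and \<open>n0 + 2\<close> yield a second one.\<close>
      have "poly F n0 * poly F (n0 + 2) = (c * c) * S 2"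
        using val[of 0] val[of 2] S0 assms(2) by simp
      then have "poly F n0 * poly F (n0 + 2) > 0" using cc S2 by simp
      then have "real_of_int (poly F n0 * poly F (n0 + 2)) > 0" by (simp only: of_int_0_less_iff)
      then have "poly (real_poly_of F) ?n * poly (real_poly_of F) (?n + 2) > 0"
        using poly_real_poly_of_int[of F n0] poly_real_poly_of_int[of F "n0 + 2"] by simp
      moreover have "poly (pderiv (real_poly_of F)) (?n + 1) \<noteq> 0"
        using hyp False poly_real_poly_of_int[of "pderiv F" "n0 + 1"]
        by (simp add: pderiv_real_poly_of)
      moreover have "poly (real_poly_of F) (?n + 1) = 0" using root1[OF g1'] by (simp add: R_def)
      ultimately obtain x where "?n < x" "x < ?n + 2" "x \<noteq> ?n + 1" "poly (real_poly_of F) x = 0"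
        using poly_second_root[of ?n "?n + 1" "?n + 2" "real_poly_of F"] by auto
      then show ?thesis
        using root1[OF g1'] by (intro exI[of _ x] exI[of _ "?n + 1"]) (auto simp: R_def)
    qed
    then obtain x y where "x \<noteq> y"
      "{x, y} \<subseteq> {x \<in> {real_of_int n0 <..< real_of_int n0 + 2}. x \<in> R}" by blast
    then show ?thesis
      using card_mono[of "{x \<in> {real_of_int n0 <..< real_of_int n0 + 2}. x \<in> R}" "{x, y}"] finR
      by (simp add: R_def)
  qed

  have lin: "\<exists>ps :: real poly list. (\<forall>p\<in>set ps. degree p = 1) \<and> real_poly_of F = prod_list ps"
    if "degree f = 1"
  proof (rule poly_splits_if_card_roots)
    have deg: "degree (real_poly_of F) \<le> d - 1"
      using degree_fpoly_le[of f c d] that by (simp add: degree_map_poly F_def)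
    show "card {x. poly (real_poly_of F) x = 0} \<ge> degree (real_poly_of F) - 1"
      using deg cardR by (simp add: R_def)
    show "degree (real_poly_of F) > 0"
    proof (rule ccontr)
      assume "\<not> degree (real_poly_of F) > 0"
      then obtain a where "real_poly_of F = [:a:]" by (auto elim: degree_eq_zeroE)
      then have "R = {}" using RF0 by (auto simp: R_def)
      then show False using cardR assms(2) by simp
    qed
  qed
  have F1: "poly F (n0 + 1) = 0" if "g 1 = -1" using val[of 1] assms(2) S1 that by simp
  have "\<forall>l\<in>{2..d - 2}. \<exists>x\<in>{real_of_int n0 + real l <..< real_of_int n0 + real l + 1}.
      poly (real_poly_of F) x = 0"
    using roots by (fastforce simp: R_def)
  then show ?thesis
    using cardR two F1 lin unfolding R_def F_def g_def by simp
qed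

end
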